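(* Let $R$ be a hemiring. The following statements are equivalent: (1) Each $h$-ideal $A$ of $R$ is $h$-idempotent, i.e. $\overline{AA}=A$. (2) $A\cap B=\overline{AB}$ for each pair $A,B$ of $h$-ideals of $R$. (3) $x\in\overline{RxRxR}$ for every $x\in R$. (4) $A\subseteq\overline{RARAR}$ for every non-empty $A\subseteq R$. (5) $A=\overline{RARAR}$ for every $h$-ideal $A$ of $R$.
   Context: A hemiring is a set $R$ with operations $+$ and $\cdot$ such that $(R,+)$ is a commutative semigroup, $(R,\cdot)$ is a semigroup, multiplication distributes over addition on both sides, and there is $0\in R$ with $a+0=0+a=a$ and $a0=0a=0$ for all $a\in R$ (no identity is assumed). An $h$-ideal of $R$ is a non-empty subset $I$ closed under addition, with $ra,ar\in I$ for all $a\in I$, $r\in R$, and such that $x+a+y=b+y$ with $a,b\in I$, $x,y\in R$ implies $x\in I$. For subsets $A,B$, $AB$ is the set of finite sums of products $ab$ with $a\in A$, $b\in B$; likewise $RARAR$ is the set of finite sums of products $ras a't$ with $r,s,t\in R$, $a,a'\in A$, and $RxRxR=R\{x\}R\{x\}R$. The $h$-closure of a non-empty $A\subseteq R$ is $\overline{A}=\{x\in R\mid x+a+y=b+y\text{ for some }a,b\in A,\ y\in R\}$. *)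

theory Defs
  imports Main
begin

text \<open>
  The class \<^class>\<open>semiring_0\<close> is exactly the notion of a hemiring: a commutative additive monoid
  with an associative multiplication that distributes over addition on both sides, and with
  absorbing zero. Neither a multiplicative identity nor commutativity of multiplication nor
  additive cancellation is assumed. The hemiring \<open>R\<close> is the whole type.
\<close>

definition h_ideal :: "'a::semiring_0 set \<Rightarrow> bool" where
  "h_ideal I \<longleftrightarrow>
     I \<noteq> {} \<and>
     (\<forall>a\<in>I. \<forall>b\<in>I. a + b \<in> I) \<and>
     (\<forall>a\<in>I. \<forall>r. r * a \<in> I \<and> a * r \<in> I) \<and>
     (\<forall>x y. \<forall>a\<in>I. \<forall>b\<in>I. x + a + y = b + y \<longrightarrow> x \<in> I)"

definition h_closure :: "'a::semiring_0 set \<Rightarrow> 'a set" where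
  "h_closure A = {x. \<exists>a\<in>A. \<exists>b\<in>A. \<exists>y. x + a + y = b + y}"

text \<open>
  Sums have at least one summand. Allowing the empty sum would add nothing to the sets of sums
  formed from h-ideals, or from \<open>R A R A R\<close> with \<open>A\<close> non-empty, since these contain \<open>0\<close> already.
\<close>

definition finite_sums :: "'a::semiring_0 set \<Rightarrow> 'a set" where
  "finite_sums S = {x. \<exists>(n::nat) f. 0 < n \<and> (\<forall>i<n. f i \<in> S) \<and> x = (\<Sum>i<n. f i)}"

definition set_prod :: "'a::semiring_0 set \<Rightarrow> 'a set \<Rightarrow> 'a set" where
  "set_prod A B = finite_sums {a * b | a b. a \<in> A \<and> b \<in> B}"

text \<open>The set \<open>R A R A R\<close>; the two factors taken from \<open>A\<close> may differ.\<close>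

definition RARAR :: "'a::semiring_0 set \<Rightarrow> 'a set" where
  "RARAR A = finite_sums {r * a * s * a' * t | r a s a' t. a \<in> A \<and> a' \<in> A}"

definition h_idempotent :: "'a::semiring_0 set \<Rightarrow> bool" where
  "h_idempotent A \<longleftrightarrow> h_closure (set_prod A A) = A"

end

theory Submission
  imports Defs
begin

text \<open>
  The essential implication is from (1) to (3). Let \<open>I\<close> be the h-ideal generated by \<open>x\<close> and let
  \<open>J\<close> be the h-closure of \<open>RxRxR\<close>, which is an h-ideal. Residual sets such as
  \<open>{a. \<forall>r s t. r a s x t \<in> J}\<close> are h-ideals; as this one contains \<open>x\<close>, it contains \<open>I\<close>, and repeating
  the argument in the other slot gives \<open>RIRIR \<subseteq> J\<close>. Since \<open>I\<close> is the least h-ideal containing the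
  products of two of its elements, the three factors from \<open>R\<close> can be removed one at a time by the
  same residual argument, whence \<open>x \<in> I \<subseteq> J\<close>.
\<close>

section \<open>Elementary properties of h-ideals\<close>

lemma h_idealD:
  assumes "h_ideal I"
  shows h_ideal_add: "a \<in> I \<Longrightarrow> b \<in> I \<Longrightarrow> a + b \<in> I"
    and h_ideal_mult_left: "a \<in> I \<Longrightarrow> r * a \<in> I"
    and h_ideal_mult_right: "a \<in> I \<Longrightarrow> a * r \<in> I"
    and h_ideal_cancel: "a \<in> I \<Longrightarrow> b \<in> I \<Longrightarrow> x + a + y = b + y \<Longrightarrow> x \<in> I"
  using assms unfolding h_ideal_def by blast+

lemma h_ideal_zero: "h_ideal I \<Longrightarrow> 0 \<in> I"
  unfolding h_ideal_def by (metis all_not_in_conv mult_zero_left)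

lemma h_ideal_Inter:
  assumes "\<And>I. I \<in> F \<Longrightarrow> h_ideal I"
  shows "h_ideal (\<Inter>F)"
proof -
  have "0 \<in> \<Inter>F"
    using assms h_ideal_zero by blast
  then show ?thesis
    unfolding h_ideal_def [of "\<Inter>F"]
    using assms by (auto intro: h_idealD)
qed

section \<open>Non-empty finite sums\<close>

lemma finite_sums_base: "a \<in> S \<Longrightarrow> a \<in> finite_sums S"
  unfolding finite_sums_def by (auto intro!: exI [of _ 1] exI [of _ "\<lambda>_. a"])

lemma finite_sums_induct [consumes 1, case_names base add]:
  assumes "x \<in> finite_sums S"
    and base: "\<And>a. a \<in> S \<Longrightarrow> P a"
    and add: "\<And>a b. P a \<Longrightarrow> P b \<Longrightarrow> P (a + b)"
  shows "P x"
proof -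
  obtain n :: nat and f where n: "0 < n" "\<forall>i<n. f i \<in> S" and x: "x = (\<Sum>i<n. f i)"
    using assms(1) unfolding finite_sums_def by blast
  from n have "P (\<Sum>i<n. f i)"
  proof (induction n)
    case 0
    then show ?case by simp
  next
    case (Suc n)
    then show ?case
      \<comment> \<open>For \<open>n = 0\<close> the sum is the single summand \<open>f 0\<close>,
        so \<open>base\<close> applies; the empty sum never arises.\<close>
      by (cases "n = 0") (auto intro: base add)
  qed
  then show ?thesis by (simp add: x)
qed

lemma finite_sums_add:
  assumes "a \<in> finite_sums S" "b \<in> finite_sums S"
  shows "a + b \<in> finite_sums S"
proof -
  obtain m :: nat and f where f: "0 < m" "\<forall>i<m. f i \<in> S" "a = (\<Sum>i<m. f i)"
    using assms(1) unfolding finite_sums_def by blast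
  obtain n :: nat and g where g: "0 < n" "\<forall>i<n. g i \<in> S" "b = (\<Sum>i<n. g i)"
    using assms(2) unfolding finite_sums_def by blast
  \<comment> \<open>\<open>?h\<close> is the concatenation of the two sequences of summands.\<close>
  let ?h = "\<lambda>i. if i < m then f i else g (i - m)"
  have "a + b = (\<Sum>i<m + n. ?h i)"
  proof -
    have "(\<Sum>i<m + k. ?h i) = (\<Sum>i<m. f i) + (\<Sum>i<k. g i)" for k
      by (induction k) (simp_all add: add.assoc)
    then show ?thesis using f g by simp
  qed
  moreover have "\<forall>i<m + n. ?h i \<in> S"
    using f g by auto
  ultimately show ?thesis
    using \<open>0 < m\<close> unfolding finite_sums_def
    by (auto intro!: exI [of _ "m + n"] exI [of _ ?h])
qed

lemma finite_sums_mono: "S \<subseteq> T \<Longrightarrow> finite_sums S \<subseteq> finite_sums T"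
  unfolding finite_sums_def by blast

lemma finite_sums_mult_left:
  assumes "x \<in> finite_sums S" "\<And>a. a \<in> S \<Longrightarrow> r * a \<in> S"
  shows "r * x \<in> finite_sums S"
  using assms(1)
  by (induction rule: finite_sums_induct)
    (auto simp: distrib_left intro: finite_sums_base finite_sums_add assms(2))

lemma finite_sums_mult_right:
  assumes "x \<in> finite_sums S" "\<And>a. a \<in> S \<Longrightarrow> a * r \<in> S"
  shows "x * r \<in> finite_sums S"
  using assms(1)
  by (induction rule: finite_sums_induct)
    (auto simp: distrib_right intro: finite_sums_base finite_sums_add assms(2))

lemma finite_sums_subset_h_ideal: "h_ideal I \<Longrightarrow> S \<subseteq> I \<Longrightarrow> finite_sums S \<subseteq> I"
  by (auto elim!: finite_sums_induct intro: h_ideal_add)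

section \<open>The h-closure\<close>

lemma h_closure_mono: "S \<subseteq> T \<Longrightarrow> h_closure S \<subseteq> h_closure T"
  unfolding h_closure_def by blast

lemma h_closure_subset_h_ideal: "h_ideal I \<Longrightarrow> S \<subseteq> I \<Longrightarrow> h_closure S \<subseteq> I"
  unfolding h_closure_def by (auto intro: h_ideal_cancel)

text \<open>For \<open>x\<close> in \<open>T\<close> the witnesses \<open>a = x\<close> and
  \<open>b = x + x\<close> work with any \<open>y\<close>, so \<open>T\<close> need not contain
  0.\<close>

lemma subset_h_closure:
  assumes "\<And>a b. a \<in> T \<Longrightarrow> b \<in> T \<Longrightarrow> a + b \<in> T"
  shows "T \<subseteq> h_closure T"
  unfolding h_closure_def using assms by blast

text \<open>The equations that witness membership can be added and multiplied by ring elements, and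
  closure of \<open>T\<close> keeps the new witnesses in \<open>T\<close>. Only the cancellation
  condition needs an elimination.\<close>

lemma h_ideal_h_closure:
  assumes "T \<noteq> {}"
    and add: "\<And>a b. a \<in> T \<Longrightarrow> b \<in> T \<Longrightarrow> a + b \<in> T"
    and left: "\<And>a r. a \<in> T \<Longrightarrow> r * a \<in> T"
    and right: "\<And>a r. a \<in> T \<Longrightarrow> a * r \<in> T"
  shows "h_ideal (h_closure T)"
  unfolding h_ideal_def
proof (intro conjI ballI allI impI)
  show "h_closure T \<noteq> {}"
    using subset_h_closure [OF add] assms(1) by blast
next
  fix a b assume "a \<in> h_closure T" "b \<in> h_closure T"
  then obtain a1 a2 u b1 b2 v where T: "a1 \<in> T" "a2 \<in> T" "b1 \<in> T" "b2 \<in> T"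
    and a: "a + a1 + u = a2 + u" and b: "b + b1 + v = b2 + v"
    unfolding h_closure_def by blast
  have "(a + b) + (a1 + b1) + (u + v) = (a + a1 + u) + (b + b1 + v)"
    by (simp add: ac_simps)
  also have "\<dots> = (a2 + b2) + (u + v)"
    unfolding a b by (simp add: ac_simps)
  finally show "a + b \<in> h_closure T"
    unfolding h_closure_def using T add by blast
next
  fix a r assume "a \<in> h_closure T"
  then obtain a1 a2 u where T: "a1 \<in> T" "a2 \<in> T" and a: "a + a1 + u = a2 + u"
    unfolding h_closure_def by blast
  have "r * a + r * a1 + r * u = r * a2 + r * u"
    using arg_cong [OF a, of "\<lambda>z. r * z"] by (simp add: distrib_left)
  then show "r * a \<in> h_closure T"
    unfolding h_closure_def using T left by blast
  have "a * r + a1 * r + u * r = a2 * r + u * r"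
    using arg_cong [OF a, of "\<lambda>z. z * r"] by (simp add: distrib_right)
  then show "a * r \<in> h_closure T"
    unfolding h_closure_def using T right by blast
next
  fix x y a b assume "a \<in> h_closure T" "b \<in> h_closure T" and x: "x + a + y = b + y"
  then obtain a1 a2 u b1 b2 v where T: "a1 \<in> T" "a2 \<in> T" "b1 \<in> T" "b2 \<in> T"
    and a: "a + a1 + u = a2 + u" and b: "b + b1 + v = b2 + v"
    unfolding h_closure_def by blast
  \<comment> \<open>Adding \<open>a1 + u + b1 + v\<close> to both sides of
    \<open>x + a + y = b + y\<close> lets \<open>a\<close> and \<open>b\<close> be replaced by
    elements of \<open>T\<close>. The witnesses for \<open>x\<close> are then \<open>a2 + b1\<close>
    and \<open>b2 + a1\<close>, with \<open>u + v + y\<close> as the common summand.\<close>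
  have "x + (a2 + b1) + (u + v + y) = x + (a2 + u) + (b1 + v + y)"
    by (simp add: ac_simps)
  also have "\<dots> = (x + a + y) + (a1 + u + b1 + v)"
    unfolding a [symmetric] by (simp add: ac_simps)
  also have "\<dots> = (b + b1 + v) + (a1 + u + y)"
    unfolding x by (simp add: ac_simps)
  also have "\<dots> = (b2 + a1) + (u + v + y)"
    unfolding b by (simp add: ac_simps)
  finally show "x \<in> h_closure T"
    unfolding h_closure_def using T add by blast
qed

section \<open>Products of h-ideals, the sets \<open>RARAR A\<close>, and residual h-ideals\<close>

lemma h_closure_set_prod_subset:
  assumes "h_ideal A" "h_ideal B"
  shows "h_closure (set_prod A B) \<subseteq> A \<inter> B"
proof -
  have "h_ideal (A \<inter> B)"
    using h_ideal_Inter [of "{A, B}"] assms by auto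
  \<comment> \<open>A product \<open>a * b\<close> is a right multiple of \<open>a\<close> and a
    left multiple of \<open>b\<close>, hence in both h-ideals.\<close>
  then show ?thesis
    unfolding set_prod_def
    using assms
    by (intro h_closure_subset_h_ideal finite_sums_subset_h_ideal)
      (auto intro: h_ideal_mult_left h_ideal_mult_right)
qed

lemma h_closure_set_prod_mono:
  "A \<subseteq> A' \<Longrightarrow> B \<subseteq> B' \<Longrightarrow> h_closure (set_prod A B) \<subseteq> h_closure (set_prod A' B')"
  unfolding set_prod_def by (intro h_closure_mono finite_sums_mono) blast

lemma h_closure_RARAR_mono: "A \<subseteq> B \<Longrightarrow> h_closure (RARAR A) \<subseteq> h_closure (RARAR B)"
  unfolding RARAR_def by (intro h_closure_mono finite_sums_mono) blast

text \<open>Grouped as \<open>(r * a * s) * (a' * t)\<close>, each generator of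
  \<open>RARAR A\<close> is a product of two elements of \<open>A\<close>.\<close>

lemma h_closure_RARAR_subset_set_prod:
  assumes "h_ideal A"
  shows "h_closure (RARAR A) \<subseteq> h_closure (set_prod A A)"
proof -
  have "\<exists>b c. r * a * s * a' * t = b * c \<and> b \<in> A \<and> c \<in> A" if "a \<in> A" "a' \<in> A" for r a s a' t
    using that assms
    by (intro exI [of _ "r * a * s"] exI [of _ "a' * t"])
      (simp add: mult.assoc h_ideal_mult_left h_ideal_mult_right)
  then show ?thesis
    unfolding RARAR_def set_prod_def by (intro h_closure_mono finite_sums_mono) blast
qed

lemma RARAR_add: "a \<in> RARAR A \<Longrightarrow> b \<in> RARAR A \<Longrightarrow> a + b \<in> RARAR A"
  unfolding RARAR_def by (rule finite_sums_add)

lemma RARAR_base: "a \<in> A \<Longrightarrow> a' \<in> A \<Longrightarrow> r * a * s * a' * t \<in> RARAR A"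
  unfolding RARAR_def by (rule finite_sums_base) blast

text \<open>\<open>RARAR A\<close> is closed under multiplication because the outer factors
  \<open>r\<close> and \<open>t\<close> absorb any further factor.\<close>

lemma h_ideal_h_closure_RARAR:
  assumes "A \<noteq> {}"
  shows "h_ideal (h_closure (RARAR A))"
proof (rule h_ideal_h_closure)
  show "RARAR A \<noteq> {}"
    using assms RARAR_base by blast
next
  fix a b assume "a \<in> RARAR A" "b \<in> RARAR A"
  then show "a + b \<in> RARAR A" by (rule RARAR_add)
next
  fix x u assume "x \<in> RARAR A"
  then show "u * x \<in> RARAR A"
    unfolding RARAR_def
    by (rule finite_sums_mult_left) (clarsimp simp flip: mult.assoc, blast)
next
  fix x u assume "x \<in> RARAR A"
  then show "x * u \<in> RARAR A"
    unfolding RARAR_def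
    by (rule finite_sums_mult_right) (clarsimp simp: mult.assoc, blast)
qed

text \<open>Additivity of each \<open>f p\<close> carries sums and cancellation back from
  \<open>J\<close>. Multiplying the argument may change the parameter, as in
  \<open>r * (u * a) = (r * u) * a\<close>, so \<open>mult\<close> assumes membership for all
  \<open>q\<close> in \<open>P\<close> at once.\<close>

lemma h_ideal_residual:
  assumes J: "h_ideal J"
    and zero: "\<And>p. p \<in> P \<Longrightarrow> f p 0 = 0"
    and add: "\<And>p a b. p \<in> P \<Longrightarrow> f p (a + b) = f p a + f p b"
    and mult: "\<And>p a r. p \<in> P \<Longrightarrow> \<forall>q\<in>P. f q a \<in> J \<Longrightarrow> f p (r * a) \<in> J \<and> f p (a * r) \<in> J"
  shows "h_ideal {a. \<forall>p\<in>P. f p a \<in> J}"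
  unfolding h_ideal_def
proof (intro conjI ballI allI impI)
  show "{a. \<forall>p\<in>P. f p a \<in> J} \<noteq> {}"
    using h_ideal_zero [OF J] by (auto simp: zero intro!: exI [of _ 0])
next
  fix x y a b
  assume ab: "a \<in> {a. \<forall>p\<in>P. f p a \<in> J}" "b \<in> {a. \<forall>p\<in>P. f p a \<in> J}" and x: "x + a + y = b + y"
  have "f p x \<in> J" if p: "p \<in> P" for p
  proof (rule h_ideal_cancel [OF J])
    show "f p x + f p a + f p y = f p b + f p y"
      using arg_cong [OF x, of "f p"] by (simp add: add p)
  qed (use ab p in auto)
  then show "x \<in> {a. \<forall>p\<in>P. f p a \<in> J}" by blast
qed (use mult in \<open>auto simp: add h_ideal_add [OF J]\<close>)

text \<open>As \<open>I\<close> is the h-closure of the sums of its own products, it lies in every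
  h-ideal containing these products.\<close>

lemma h_idempotent_subset:
  assumes "h_idempotent I" "h_ideal K" "\<And>a b. a \<in> I \<Longrightarrow> b \<in> I \<Longrightarrow> a * b \<in> K"
  shows "I \<subseteq> K"
proof -
  have "h_closure (set_prod I I) \<subseteq> K"
    unfolding set_prod_def
    by (intro h_closure_subset_h_ideal finite_sums_subset_h_ideal assms(2)) (use assms(3) in blast)
  then show ?thesis
    using assms(1) by (simp add: h_idempotent_def)
qed

section \<open>From idempotence of all h-ideals to \<open>x\<close> in the h-closure of
  \<open>RxRxR\<close>\<close>

lemma mem_h_closure_RARAR_singleton:
  fixes x :: "'a::semiring_0"
  assumes idem: "\<And>A :: 'a set. h_ideal A \<Longrightarrow> h_idempotent A"
  shows "x \<in> h_closure (RARAR {x})"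
proof -
  define J where "J = h_closure (RARAR {x})"
  define I where "I = \<Inter>{K. h_ideal K \<and> x \<in> K}"
  have J: "h_ideal J"
    unfolding J_def by (rule h_ideal_h_closure_RARAR) simp
  have I: "h_ideal I"
    unfolding I_def by (rule h_ideal_Inter) simp
  have least: "I \<subseteq> K" if "h_ideal K" "x \<in> K" for K
    using that unfolding I_def by blast
  have gen: "r * x * s * x * t \<in> J" for r s t
    unfolding J_def using subset_h_closure [OF RARAR_add] RARAR_base by blast

  \<comment> \<open>First slot: a factor on the left of \<open>a\<close> goes into \<open>r\<close>,
    one on the right into \<open>s\<close>.\<close>
  let ?K = "{a. \<forall>p\<in>UNIV. (case p of (r, s, t) \<Rightarrow> r * a * s * x * t) \<in> J}"
  have "h_ideal ?K"
    by (rule h_ideal_residual [OF J])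
      (auto simp: distrib_left distrib_right simp flip: mult.assoc, metis mult.assoc)
  then have "I \<subseteq> ?K"
    by (rule least) (simp add: gen)
  then have left: "r * a * s * x * t \<in> J" if "a \<in> I" for r a s t
    using that by auto

  \<comment> \<open>Second slot, with the first already ranging over \<open>I\<close>;
    \<open>left\<close> says that \<open>x\<close> belongs to \<open>?K\<close>.\<close>
  let ?K = "{b. \<forall>p\<in>UNIV \<times> I \<times> UNIV. (case p of (r, a, s, t) \<Rightarrow> r * a * s * b * t) \<in> J}"
  have "h_ideal ?K"
    by (rule h_ideal_residual [OF J])
      (auto simp: distrib_left distrib_right simp flip: mult.assoc, (metis mult.assoc)+)
  then have "I \<subseteq> ?K"
    by (rule least) (simp add: left)
  then have five: "r * a * s * b * t \<in> J" if "a \<in> I" "b \<in> I" for r a s b t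
    using that by auto

  \<comment> \<open>Removal of \<open>r\<close>: for \<open>a = c * d\<close> with \<open>c\<close>,
    \<open>d\<close> in \<open>I\<close>, \<open>five\<close> applies with \<open>c\<close> as the
    factor \<open>r\<close>. Left multiples of \<open>a\<close> are absorbed by \<open>J\<close>
    itself.\<close>
  let ?K = "{a. \<forall>p\<in>UNIV \<times> I \<times> UNIV. (case p of (s, b, t) \<Rightarrow> a * s * b * t) \<in> J}"
  have "h_ideal ?K"
    by (rule h_ideal_residual [OF J])
      (auto simp: distrib_left distrib_right mult.assoc h_ideal_mult_left [OF J],
        metis mult.assoc)
  then have "I \<subseteq> ?K"
    by (rule h_idempotent_subset [OF idem [OF I]]) (auto simp: five)
  then have four: "a * s * b * t \<in> J" if "a \<in> I" "b \<in> I" for a s b t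
    using that by auto

  \<comment> \<open>Removal of \<open>s\<close>: for \<open>b = c * d\<close>, \<open>four\<close>
    applies with \<open>c\<close> as the factor \<open>s\<close>. A factor on the left of
    \<open>b\<close> is moved into \<open>a\<close>, which stays in \<open>I\<close>.\<close>
  let ?K = "{b. \<forall>p\<in>I \<times> UNIV. (case p of (a, t) \<Rightarrow> a * b * t) \<in> J}"
  have "h_ideal ?K"
    by (rule h_ideal_residual [OF J])
      (auto simp: distrib_left distrib_right h_ideal_mult_right [OF I] simp flip: mult.assoc,
        simp add: mult.assoc)
  then have "I \<subseteq> ?K"
    by (rule h_idempotent_subset [OF idem [OF I]]) (auto simp: four simp flip: mult.assoc)
  then have three: "a * b * t \<in> J" if "a \<in> I" "b \<in> I" for a b t
    using that by auto

  \<comment> \<open>Removal of \<open>t\<close>: for \<open>b = c * d\<close>, \<open>three\<close>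
    applies to \<open>a\<close>, \<open>c\<close> with \<open>d\<close> as the factor
    \<open>t\<close>.\<close>
  let ?K = "{b. \<forall>a\<in>I. a * b \<in> J}"
  have "h_ideal ?K"
    by (rule h_ideal_residual [OF J])
      (auto simp: distrib_left h_ideal_mult_right [OF I] h_ideal_mult_right [OF J]
        simp flip: mult.assoc)
  then have "I \<subseteq> ?K"
    by (rule h_idempotent_subset [OF idem [OF I]]) (auto simp: three simp flip: mult.assoc)
  then have "a * b \<in> J" if "a \<in> I" "b \<in> I" for a b
    using that by auto
  then have "I \<subseteq> J"
    by (rule h_idempotent_subset [OF idem [OF I] J])
  then show ?thesis
    unfolding I_def J_def by blast
qed

section \<open>Implications between the five conditions\<close>

theorem proposition4p1:
  shows
    "((\<forall>A :: 'a::semiring_0 set. h_ideal A \<longrightarrow> h_idempotent A)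
      \<longleftrightarrow> (\<forall>A B :: 'a set. h_ideal A \<longrightarrow> h_ideal B \<longrightarrow> A \<inter> B = h_closure (set_prod A B))) \<and>
     ((\<forall>A :: 'a set. h_ideal A \<longrightarrow> h_idempotent A)
      \<longleftrightarrow> (\<forall>x :: 'a. x \<in> h_closure (RARAR {x}))) \<and>
     ((\<forall>A :: 'a set. h_ideal A \<longrightarrow> h_idempotent A)
      \<longleftrightarrow> (\<forall>A :: 'a set. A \<noteq> {} \<longrightarrow> A \<subseteq> h_closure (RARAR A))) \<and>
     ((\<forall>A :: 'a set. h_ideal A \<longrightarrow> h_idempotent A)
      \<longleftrightarrow> (\<forall>A :: 'a set. h_ideal A \<longrightarrow> A = h_closure (RARAR A)))"
    (is "(?P1 \<longleftrightarrow> ?P2) \<and> (?P1 \<longleftrightarrow> ?P3) \<and> (?P1 \<longleftrightarrow> ?P4) \<and> (?P1 \<longleftrightarrow> ?P5)")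
proof -
  \<comment> \<open>\<open>?P1\<close> and \<open>?P2\<close> imply each other; the rest is the
    cycle from \<open>?P1\<close> through \<open>?P3\<close>, \<open>?P4\<close> and
    \<open>?P5\<close> back to \<open>?P1\<close>.\<close>
  have "?P2" if ?P1
  proof (intro allI impI)
    fix A B :: "'a set" assume AB: "h_ideal A" "h_ideal B"
    then have "h_ideal (A \<inter> B)"
      using h_ideal_Inter [of "{A, B}"] by auto
    \<comment> \<open>Idempotence is applied to the h-ideal \<open>A \<inter> B\<close>, whose
      products of two elements are products of an element of \<open>A\<close> by one of
      \<open>B\<close>.\<close>
    then have "A \<inter> B = h_closure (set_prod (A \<inter> B) (A \<inter> B))"
      using that by (simp add: h_idempotent_def)
    also have "\<dots> \<subseteq> h_closure (set_prod A B)"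
      by (rule h_closure_set_prod_mono) auto
    finally show "A \<inter> B = h_closure (set_prod A B)"
      using h_closure_set_prod_subset [OF AB] by blast
  qed
  moreover have "?P1" if ?P2
    using that by (auto simp: h_idempotent_def)
  moreover have "?P3" if ?P1
    using that mem_h_closure_RARAR_singleton by blast
  \<comment> \<open>Each \<open>x\<close> in \<open>A\<close> lies in the h-closure of
    \<open>RARAR {x}\<close>, which grows with the set.\<close>
  moreover have "?P4" if ?P3
    using that h_closure_RARAR_mono [of "{_}"] by blast
  moreover have "?P5" if ?P4
  proof (intro allI impI)
    fix A :: "'a set" assume A: "h_ideal A"
    have "h_closure (RARAR A) \<subseteq> A"
      using h_closure_RARAR_subset_set_prod [OF A] h_closure_set_prod_subset [OF A A] by blast
    moreover have "A \<subseteq> h_closure (RARAR A)"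
      using that h_ideal_zero [OF A] by blast
    ultimately show "A = h_closure (RARAR A)" by blast
  qed
  moreover have "?P1" if ?P5
  proof (intro allI impI)
    fix A :: "'a set" assume A: "h_ideal A"
    then have "A = h_closure (RARAR A)"
      using that by blast
    then have "A \<subseteq> h_closure (set_prod A A)"
      using h_closure_RARAR_subset_set_prod [OF A] by blast
    then show "h_idempotent A"
      unfolding h_idempotent_def using h_closure_set_prod_subset [OF A A] by blast
  qed
  ultimately show ?thesis by argo
qed

end
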